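(* For every relation $r\subseteq\Sigma\times\Sigma$ and every variable $x\in V$: (1) if $\mathsf E_xr=\mathsf E^{\mathsf{last}}_xr$, then $\mathbf{guar}(\mathsf E_xr)=\mathsf E_x(\mathbf{guar}\,r)$; (2) if $\mathsf E_xr=\mathsf E^{\mathsf{last}}_xr$, then $\mathbf{demand}(\mathsf E_xr)=\mathsf E_x(\mathbf{demand}\,r)$; (3) if $\mathsf E_xr=r$, then $\mathbf{rely}(\mathsf E_xr)=\mathsf E_x(\mathbf{rely}\,r)$.
   Context: Commands. $(\mathcal C,\le,\bigwedge,\bigsqcup,\bot,\top)$ is a complete distributive lattice (with arbitrary meet $\bigwedge$, binary meet $\sqcap$, arbitrary join $\bigsqcup$ and binary join $\sqcup$) whose elements are called commands. It has an associative sequential composition $;$ with identity $\mathbf{nil}$, monotone in both arguments, and an associative, commutative, idempotent, monotone weak conjunction $\Cap$. Iterations: $c^0=\mathbf{nil}$, $c^{i+1}=c;c^i$; $c^\star$ (resp. $c^\omega$) is the least (resp. greatest) fixed point of $y\mapsto\mathbf{nil}\sqcup c;y$; $c^\infty=c^\omega;\bot$. One has $c^\star=\bigsqcup_{i\in\mathbb N}c^i$ and $c^\omega=c^\star\sqcup c^\infty$. States and relations. $V$ is a countable set of variables, $S$ a set, $\Sigma$ the set of partial functions $V\rightharpoonup S$. $\mathrm{id}(\overline x)$ relates $\sigma,\sigma'\in\Sigma$ iff they agree on every variable other than $x$. For $p\subseteq\Sigma$, $\mathsf E_x p$ is the image of $p$ under $\mathrm{id}(\overline x)$. For $r\subseteq\Sigma\times\Sigma$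 (with $\circ$ denoting left-to-right relational composition), $\mathsf E^{\mathsf{first}}_x r=\mathrm{id}(\overline x)\circ r$, $\mathsf E^{\mathsf{last}}_x r=r\circ\mathrm{id}(\overline x)$, $\mathsf E_x r=\mathrm{id}(\overline x)\circ r\circ\mathrm{id}(\overline x)$. $\overline r$ is the complement of $r$ in $\Sigma\times\Sigma$. Primitive commands. $\tau:\mathcal P(\Sigma)\to\mathcal C$ (tests) and $\pi,\epsilon:\mathcal P(\Sigma\times\Sigma)\to\mathcal A$ (program and environment steps) are injective homomorphisms of complete Boolean algebras onto complete Boolean sub-algebras of $\mathcal C$ (joins, and nonempty meets, computed in $\mathcal C$; complement relative to the greatest element of the sub-algebra), with $\tau(\emptyset)=\pi(\emptyset)=\epsilon(\emptyset)=\bot$ and $\tau(\Sigma)=\mathbf{nil}$. $\mathcal A\subseteq\mathcal C$ is the complete Boolean sub-algebra of atomic steps, in which $\boldsymbol\pi=\pi(\Sigma\times\Sigma)$ and $\boldsymbol\epsilon=\epsilon(\Sigma\times\Sigma)$ are complementary; $\boldsymbol\alpha=\boldsymbol\pi\sqcup\boldsymbol\epsilon$. $\mathbf{chaos}=\boldsymbol\alpha^\omega$ is the identity of $\Cap$, and $a=a\Cap(\boldsymbol\alpha;\mathbf{chaos})$ for all $a\in\mathcal A$. Localisation. For each $x\in V$ there are unary operators $\mathsf E_x,\mathsf E^{\mathsf{first}}_x,\mathsf E^{\mathsf{last}}_x$ on $\mathcal C$ (binding tighter than binary operators). Each family $F\in\{\mathsf E,\mathsf E^{\mathsf{first}},\mathsf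 E^{\mathsf{last}}\}$ satisfies $c\le F_xc$; $F_x(c\sqcap F_xd)=F_xc\sqcap F_xd$; $F_xF_yc=F_yF_xc$; $F_x(\bigsqcup C)=\bigsqcup_{c\in C}F_xc$. Further axioms: $\mathsf E^{\mathsf{first}}_xc\le\mathsf E_xc$; $\mathsf E^{\mathsf{last}}_xc\le\mathsf E_xc$; $\mathsf E_x\mathsf E^{\mathsf{first}}_yc=\mathsf E^{\mathsf{first}}_y\mathsf E_xc$; $\mathsf E_x\mathsf E^{\mathsf{last}}_yc=\mathsf E^{\mathsf{last}}_y\mathsf E_xc$; $\mathsf E^{\mathsf{first}}_x\mathsf E^{\mathsf{last}}_yc=\mathsf E^{\mathsf{last}}_y\mathsf E^{\mathsf{first}}_xc$; $\mathsf E_x\tau(p)=\mathsf E^{\mathsf{first}}_x\tau(p)=\mathsf E^{\mathsf{last}}_x\tau(p)=\tau(\mathsf E_xp)$; $F_x\pi(r)=\pi(F_xr)$ and $F_x\epsilon(r)=\epsilon(F_xr)$ for each of the three $F$; $\mathsf E_x(c;\mathsf E^{\mathsf{first}}_xd)=\mathsf E_xc;\mathsf E_xd=\mathsf E_x(\mathsf E^{\mathsf{last}}_xc;d)$; if $c=c\Cap(\boldsymbol\alpha;\mathbf{chaos})$ then $\mathsf E^{\mathsf{first}}_x(c;d)=\mathsf E^{\mathsf{first}}_xc;d$ and $\mathsf E^{\mathsf{last}}_x(d;c)=d;\mathsf E^{\mathsf{last}}_xc$; $\mathsf E_x(c\Cap\mathsf E_xd)=\mathsf E_xc\Cap\mathsf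 E_xd$; $\mathsf E^{\mathsf{first}}_x(c\Cap\mathsf E^{\mathsf{first}}_xd)=\mathsf E^{\mathsf{first}}_xc\Cap\mathsf E^{\mathsf{first}}_xd$; for $a\in\mathcal A$ with $\mathsf E_xa=\mathsf E^{\mathsf{last}}_xa$, $\mathsf E_x(a^\infty)=(\mathsf E_xa)^\infty$. Derived commands. $\mathbf{guar}\,g=(\pi(g)\sqcup\boldsymbol\epsilon)^\omega$; $\mathbf{demand}\,r=(\epsilon(r)\sqcup\boldsymbol\pi)^\omega$; $\mathbf{rely}\,r=(\boldsymbol\alpha\sqcup\epsilon(\overline r);\top)^\omega$, and in this algebra $\mathbf{rely}\,r=\boldsymbol\alpha^\omega;(\mathbf{nil}\sqcup\epsilon(\overline r);\top)$. *)

theory Defs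
  imports Main "HOL-Library.Countable_Set"
begin

unbundle lattice_syntax

text \<open>The lattice of commands is the whole type \<open>'c\<close>.  Variables and values are carrier sets
  (the set of values may be empty), so the operators taking variables, sets of states or
  relations are only constrained on arguments within these carriers.
  \<open>\<otimes>\<close> is weak conjunction.\<close>

record ('v, 's, 'c) command_structure =
  vars :: "'v set"
  vals :: "'s set"
  seq :: "'c \<Rightarrow> 'c \<Rightarrow> 'c"  (infixl \<open>;;\<index>\<close> 75)
  nil :: "'c"  (\<open>nil\<index>\<close>)
  wconj :: "'c \<Rightarrow> 'c \<Rightarrow> 'c"  (infixl \<open>\<otimes>\<index>\<close> 70)
  test :: "('v \<rightharpoonup> 's) set \<Rightarrow> 'c"  (\<open>\<tau>\<index>\<close>)
  pgm :: "('v \<rightharpoonup> 's) rel \<Rightarrow> 'c"  (\<open>\<pi>\<index>\<close>)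
  env :: "('v \<rightharpoonup> 's) rel \<Rightarrow> 'c"  (\<open>\<epsilon>\<index>\<close>)
  atomic :: "'c set"
  loc :: "'v \<Rightarrow> 'c \<Rightarrow> 'c"
  loc_first :: "'v \<Rightarrow> 'c \<Rightarrow> 'c"
  loc_last :: "'v \<Rightarrow> 'c \<Rightarrow> 'c"

definition states :: "('v, 's, 'c, 'm) command_structure_scheme \<Rightarrow> ('v \<rightharpoonup> 's) set" where
  "states K = {\<sigma>. dom \<sigma> \<subseteq> vars K \<and> ran \<sigma> \<subseteq> vals K}"

definition id_except ::
  "('v, 's, 'c, 'm) command_structure_scheme \<Rightarrow> 'v \<Rightarrow> ('v \<rightharpoonup> 's) rel" where
  "id_except K x =
    {(\<sigma>, \<sigma>') \<in> states K \<times> states K. \<forall>y \<in> vars K. y \<noteq> x \<longrightarrow> \<sigma> y = \<sigma>' y}"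

definition set_loc ::
  "('v, 's, 'c, 'm) command_structure_scheme \<Rightarrow> 'v \<Rightarrow> ('v \<rightharpoonup> 's) set \<Rightarrow> ('v \<rightharpoonup> 's) set" where
  "set_loc K x p = id_except K x `` p"

definition rel_loc_first ::
  "('v, 's, 'c, 'm) command_structure_scheme \<Rightarrow> 'v \<Rightarrow> ('v \<rightharpoonup> 's) rel \<Rightarrow> ('v \<rightharpoonup> 's) rel" where
  "rel_loc_first K x r = id_except K x O r"

definition rel_loc_last ::
  "('v, 's, 'c, 'm) command_structure_scheme \<Rightarrow> 'v \<Rightarrow> ('v \<rightharpoonup> 's) rel \<Rightarrow> ('v \<rightharpoonup> 's) rel" where
  "rel_loc_last K x r = r O id_except K x"

definition rel_loc ::
  "('v, 's, 'c, 'm) command_structure_scheme \<Rightarrow> 'v \<Rightarrow> ('v \<rightharpoonup> 's) rel \<Rightarrow> ('v \<rightharpoonup> 's) rel" where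
  "rel_loc K x r = id_except K x O r O id_except K x"

definition all_rel :: "('v, 's, 'c, 'm) command_structure_scheme \<Rightarrow> ('v \<rightharpoonup> 's) rel" where
  "all_rel K = states K \<times> states K"

definition rel_compl ::
  "('v, 's, 'c, 'm) command_structure_scheme \<Rightarrow> ('v \<rightharpoonup> 's) rel \<Rightarrow> ('v \<rightharpoonup> 's) rel" where
  "rel_compl K r = all_rel K - r"

primrec cpow ::
  "('v, 's, 'c, 'm) command_structure_scheme \<Rightarrow> 'c \<Rightarrow> nat \<Rightarrow> 'c" where
  "cpow K c 0 = nil\<^bsub>K\<^esub>"
| "cpow K c (Suc i) = c ;;\<^bsub>K\<^esub> cpow K c i"

definition star ::
  "('v, 's, 'c::complete_lattice, 'm) command_structure_scheme \<Rightarrow> 'c \<Rightarrow> 'c" where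
  "star K c = lfp (\<lambda>y. nil\<^bsub>K\<^esub> \<squnion> c ;;\<^bsub>K\<^esub> y)"

definition omega ::
  "('v, 's, 'c::complete_lattice, 'm) command_structure_scheme \<Rightarrow> 'c \<Rightarrow> 'c" where
  "omega K c = gfp (\<lambda>y. nil\<^bsub>K\<^esub> \<squnion> c ;;\<^bsub>K\<^esub> y)"

definition infin ::
  "('v, 's, 'c::complete_lattice, 'm) command_structure_scheme \<Rightarrow> 'c \<Rightarrow> 'c" where
  "infin K c = omega K c ;;\<^bsub>K\<^esub> \<bottom>"

definition any_pgm :: "('v, 's, 'c, 'm) command_structure_scheme \<Rightarrow> 'c" where
  "any_pgm K = \<pi>\<^bsub>K\<^esub> (all_rel K)"

definition any_env :: "('v, 's, 'c, 'm) command_structure_scheme \<Rightarrow> 'c" where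
  "any_env K = \<epsilon>\<^bsub>K\<^esub> (all_rel K)"

definition any_step ::
  "('v, 's, 'c::complete_lattice, 'm) command_structure_scheme \<Rightarrow> 'c" where
  "any_step K = any_pgm K \<squnion> any_env K"

definition chaos ::
  "('v, 's, 'c::complete_lattice, 'm) command_structure_scheme \<Rightarrow> 'c" where
  "chaos K = omega K (any_step K)"

definition guar ::
  "('v, 's, 'c::complete_lattice, 'm) command_structure_scheme \<Rightarrow> ('v \<rightharpoonup> 's) rel \<Rightarrow> 'c" where
  "guar K g = omega K (\<pi>\<^bsub>K\<^esub> g \<squnion> any_env K)"

definition demand ::
  "('v, 's, 'c::complete_lattice, 'm) command_structure_scheme \<Rightarrow> ('v \<rightharpoonup> 's) rel \<Rightarrow> 'c" where
  "demand K r = omega K (\<epsilon>\<^bsub>K\<^esub> r \<squnion> any_pgm K)"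

definition rely ::
  "('v, 's, 'c::complete_lattice, 'm) command_structure_scheme \<Rightarrow> ('v \<rightharpoonup> 's) rel \<Rightarrow> 'c" where
  "rely K r = omega K (any_step K \<squnion> \<epsilon>\<^bsub>K\<^esub> (rel_compl K r) ;;\<^bsub>K\<^esub> \<top>)"

definition complement_in :: "'c::complete_lattice \<Rightarrow> 'c \<Rightarrow> 'c \<Rightarrow> bool" where
  "complement_in t b b' \<longleftrightarrow> b \<sqinter> b' = \<bottom> \<and> b \<squnion> b' = t"

text \<open>The greatest element of a sub-algebra need not be \<open>\<top>\<close>: the empty meet is exempt, and
  complements are taken relative to the greatest element \<open>\<Squnion>B\<close>.  The empty join forces
  \<open>\<bottom> \<in> B\<close>.\<close>

definition complete_boolean_subalgebra :: "'c::{complete_lattice, distrib_lattice} set \<Rightarrow> bool" where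
  "complete_boolean_subalgebra B \<longleftrightarrow>
    (\<forall>D \<subseteq> B. \<Squnion>D \<in> B) \<and>
    (\<forall>D \<subseteq> B. D \<noteq> {} \<longrightarrow> \<Sqinter>D \<in> B) \<and>
    (\<forall>b \<in> B. \<exists>b' \<in> B. complement_in (\<Squnion>B) b b')"

text \<open>An injective homomorphism of complete Boolean algebras from the powerset of \<open>U\<close> onto a
  complete Boolean sub-algebra of the commands.\<close>

definition boolean_embedding ::
  "'a set \<Rightarrow> ('a set \<Rightarrow> 'c::{complete_lattice, distrib_lattice}) \<Rightarrow> bool" where
  "boolean_embedding U f \<longleftrightarrow>
    inj_on f (Pow U) \<and>
    complete_boolean_subalgebra (f ` Pow U) \<and>
    (\<forall>P \<subseteq> Pow U. f (\<Union>P) = \<Squnion>(f ` P)) \<and>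
    (\<forall>P \<subseteq> Pow U. P \<noteq> {} \<longrightarrow> f (\<Inter>P) = \<Sqinter>(f ` P)) \<and>
    (\<forall>p \<subseteq> U. complement_in (f U) (f p) (f (U - p)))"

text \<open>Sequential composition is only assumed monotone, from which \<open>star_eq_Sup\<close>, \<open>omega_decomp\<close> and
  \<open>rely_alt\<close> do not follow; they are therefore part of the axiomatisation.\<close>

locale command_algebra =
  fixes K :: "('v, 's, 'c::{complete_lattice, distrib_lattice}, 'm) command_structure_scheme"
    (structure)
  assumes countable_vars: "countable (vars K)"
    and seq_assoc: "(c ;; d) ;; e = c ;; (d ;; e)"
    and nil_seq: "nil ;; c = c"
    and seq_nil: "c ;; nil = c"
    and seq_mono: "c \<le> c' \<Longrightarrow> d \<le> d' \<Longrightarrow> c ;; d \<le> c' ;; d'"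
    and wconj_assoc: "(c \<otimes> d) \<otimes> e = c \<otimes> (d \<otimes> e)"
    and wconj_commute: "c \<otimes> d = d \<otimes> c"
    and wconj_idem: "c \<otimes> c = c"
    and wconj_mono: "c \<le> c' \<Longrightarrow> d \<le> d' \<Longrightarrow> c \<otimes> d \<le> c' \<otimes> d'"
    and star_eq_Sup: "star K c = (\<Squnion>i. cpow K c i)"
    and omega_decomp: "omega K c = star K c \<squnion> infin K c"
    and test_embedding: "boolean_embedding (states K) \<tau>"
    and pgm_embedding: "boolean_embedding (all_rel K) \<pi>"
    and env_embedding: "boolean_embedding (all_rel K) \<epsilon>"
    and test_empty: "\<tau> {} = \<bottom>"
    and pgm_empty: "\<pi> {} = \<bottom>"
    and env_empty: "\<epsilon> {} = \<bottom>"
    and test_states: "\<tau> (states K) = nil"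
    and atomic_subalgebra: "complete_boolean_subalgebra (atomic K)"
    and pgm_atomic: "r \<subseteq> all_rel K \<Longrightarrow> \<pi> r \<in> atomic K"
    and env_atomic: "r \<subseteq> all_rel K \<Longrightarrow> \<epsilon> r \<in> atomic K"
    and pgm_env_complement: "complement_in (\<Squnion>(atomic K)) (any_pgm K) (any_env K)"
    and wconj_chaos: "c \<otimes> chaos K = c"
    and atomic_wconj: "a \<in> atomic K \<Longrightarrow> a = a \<otimes> (any_step K ;; chaos K)"
    and rely_alt: "r \<subseteq> all_rel K \<Longrightarrow>
      rely K r = omega K (any_step K) ;; (nil \<squnion> \<epsilon> (rel_compl K r) ;; \<top>)"

definition localisation_family ::
  "'v set \<Rightarrow> ('v \<Rightarrow> 'c::complete_lattice \<Rightarrow> 'c) \<Rightarrow> bool" where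
  "localisation_family V F \<longleftrightarrow>
    (\<forall>x \<in> V. \<forall>c. c \<le> F x c) \<and>
    (\<forall>x \<in> V. \<forall>c d. F x (c \<sqinter> F x d) = F x c \<sqinter> F x d) \<and>
    (\<forall>x \<in> V. \<forall>y \<in> V. \<forall>c. F x (F y c) = F y (F x c)) \<and>
    (\<forall>x \<in> V. \<forall>C. F x (\<Squnion>C) = (\<Squnion>c \<in> C. F x c))"

locale localised_command_algebra = command_algebra +
  assumes loc_family: "localisation_family (vars K) (loc K)"
    and loc_first_family: "localisation_family (vars K) (loc_first K)"
    and loc_last_family: "localisation_family (vars K) (loc_last K)"
    and loc_first_le_loc: "x \<in> vars K \<Longrightarrow> loc_first K x c \<le> loc K x c"
    and loc_last_le_loc: "x \<in> vars K \<Longrightarrow> loc_last K x c \<le> loc K x c"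
    and loc_loc_first_commute: "x \<in> vars K \<Longrightarrow> y \<in> vars K \<Longrightarrow>
      loc K x (loc_first K y c) = loc_first K y (loc K x c)"
    and loc_loc_last_commute: "x \<in> vars K \<Longrightarrow> y \<in> vars K \<Longrightarrow>
      loc K x (loc_last K y c) = loc_last K y (loc K x c)"
    and loc_first_loc_last_commute: "x \<in> vars K \<Longrightarrow> y \<in> vars K \<Longrightarrow>
      loc_first K x (loc_last K y c) = loc_last K y (loc_first K x c)"
    and loc_test: "x \<in> vars K \<Longrightarrow> p \<subseteq> states K \<Longrightarrow> loc K x (\<tau> p) = \<tau> (set_loc K x p)"
    and loc_first_test: "x \<in> vars K \<Longrightarrow> p \<subseteq> states K \<Longrightarrow>
      loc_first K x (\<tau> p) = \<tau> (set_loc K x p)"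
    and loc_last_test: "x \<in> vars K \<Longrightarrow> p \<subseteq> states K \<Longrightarrow>
      loc_last K x (\<tau> p) = \<tau> (set_loc K x p)"
    and loc_pgm: "x \<in> vars K \<Longrightarrow> r \<subseteq> all_rel K \<Longrightarrow> loc K x (\<pi> r) = \<pi> (rel_loc K x r)"
    and loc_first_pgm: "x \<in> vars K \<Longrightarrow> r \<subseteq> all_rel K \<Longrightarrow>
      loc_first K x (\<pi> r) = \<pi> (rel_loc_first K x r)"
    and loc_last_pgm: "x \<in> vars K \<Longrightarrow> r \<subseteq> all_rel K \<Longrightarrow>
      loc_last K x (\<pi> r) = \<pi> (rel_loc_last K x r)"
    and loc_env: "x \<in> vars K \<Longrightarrow> r \<subseteq> all_rel K \<Longrightarrow> loc K x (\<epsilon> r) = \<epsilon> (rel_loc K x r)"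
    and loc_first_env: "x \<in> vars K \<Longrightarrow> r \<subseteq> all_rel K \<Longrightarrow>
      loc_first K x (\<epsilon> r) = \<epsilon> (rel_loc_first K x r)"
    and loc_last_env: "x \<in> vars K \<Longrightarrow> r \<subseteq> all_rel K \<Longrightarrow>
      loc_last K x (\<epsilon> r) = \<epsilon> (rel_loc_last K x r)"
    and loc_seq_loc_first: "x \<in> vars K \<Longrightarrow>
      loc K x (c ;; loc_first K x d) = loc K x c ;; loc K x d"
    and loc_loc_last_seq: "x \<in> vars K \<Longrightarrow>
      loc K x (loc_last K x c ;; d) = loc K x c ;; loc K x d"
    and loc_first_seq: "x \<in> vars K \<Longrightarrow> c = c \<otimes> (any_step K ;; chaos K) \<Longrightarrow>
      loc_first K x (c ;; d) = loc_first K x c ;; d"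
    and loc_last_seq: "x \<in> vars K \<Longrightarrow> c = c \<otimes> (any_step K ;; chaos K) \<Longrightarrow>
      loc_last K x (d ;; c) = d ;; loc_last K x c"
    and loc_wconj: "x \<in> vars K \<Longrightarrow>
      loc K x (c \<otimes> loc K x d) = loc K x c \<otimes> loc K x d"
    and loc_first_wconj: "x \<in> vars K \<Longrightarrow>
      loc_first K x (c \<otimes> loc_first K x d) = loc_first K x c \<otimes> loc_first K x d"
    and loc_infin: "x \<in> vars K \<Longrightarrow> a \<in> atomic K \<Longrightarrow> loc K x a = loc_last K x a \<Longrightarrow>
      loc K x (infin K a) = infin K (loc K x a)"

end

theory Submission
  imports Defs
begin

text \<open>If \<open>E a = E_last a\<close>, then in \<open>E (d ;; a)\<close> the final step may be localised at its end, and
  the result \<open>E a\<close> is a fixed point of \<open>E_first\<close>, so \<open>E\<close> splits over the composition.  Peeling steps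
  off the right end of \<open>a\<^sup>i\<close> shows that \<open>E\<close> commutes with finite iteration; the infinite
  part is axiomatic.  For the rely command one uses the form
  \<open>chaos ;; (nil \<squnion> \<epsilon>(- r) ;; \<top>)\<close>, whose second factor is fixed by \<open>E_first\<close> because the
  complement of an \<open>x\<close>-invariant relation is \<open>x\<close>-invariant.\<close>

lemma id_except_refl: "s \<in> states K \<Longrightarrow> (s, s) \<in> id_except K x"
  by (simp add: id_except_def)

lemma id_except_sym: "(s, t) \<in> id_except K x \<Longrightarrow> (t, s) \<in> id_except K x"
  by (auto simp: id_except_def)

lemma id_except_subset: "id_except K x \<subseteq> states K \<times> states K"
  by (auto simp: id_except_def)

text \<open>Because \<open>nil\<close> is the test of all states, this is what makes
  \<open>nil\<close> a fixed point of localisation.\<close>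

lemma set_loc_states: "set_loc K x (states K) = states K"
  using id_except_refl[of _ K x] id_except_subset[of K x] by (auto simp: set_loc_def)

lemma rel_loc_all_rel: "rel_loc K x (all_rel K) = all_rel K"
  using id_except_refl[of _ K x] id_except_subset[of K x]
  unfolding rel_loc_def all_rel_def by blast

lemma rel_loc_last_all_rel: "rel_loc_last K x (all_rel K) = all_rel K"
  using id_except_refl[of _ K x] id_except_subset[of K x]
  unfolding rel_loc_last_def all_rel_def by blast

text \<open>\<open>id_except\<close> is reflexive on states, so any pair produced by a leading
  \<open>id_except\<close> step can be padded with a trivial trailing one and then lies in
  \<open>rel_loc K x r\<close>.\<close>

lemma rel_loc_first_eq_self:
  assumes "r \<subseteq> all_rel K" "rel_loc K x r = r"
  shows "rel_loc_first K x r = r"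
proof
  have *: "(s, v) \<in> r"
    if "(s, t) \<in> id_except K x" "(t, u) \<in> r" "(u, v) \<in> id_except K x" for s t u v
    using that assms(2) unfolding rel_loc_def by blast
  have refl: "(s, s) \<in> id_except K x \<and> (t, t) \<in> id_except K x" if "(s, t) \<in> r" for s t
    using that assms(1) id_except_refl[of _ K x] unfolding all_rel_def by blast
  show "rel_loc_first K x r \<subseteq> r"
    unfolding rel_loc_first_def using * refl by blast
  show "r \<subseteq> rel_loc_first K x r"
    unfolding rel_loc_first_def by (clarify, rule relcompI[OF conjunct1[OF refl]])
qed

text \<open>\<open>id_except\<close> is symmetric: if steps from a pair outside \<open>r\<close> led
  to a pair inside \<open>r\<close>, running them backwards would put the first pair in
  \<open>r\<close> as well.\<close>

lemma rel_loc_rel_compl: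
  assumes "rel_loc K x r = r"
  shows "rel_loc K x (rel_compl K r) = rel_compl K r"
proof
  have *: "(s, v) \<in> r"
    if "(s, t) \<in> id_except K x" "(t, u) \<in> r" "(u, v) \<in> id_except K x" for s t u v
    using that assms unfolding rel_loc_def by blast
  show "rel_loc K x (rel_compl K r) \<subseteq> rel_compl K r"
  proof clarify
    fix s v assume "(s, v) \<in> rel_loc K x (rel_compl K r)"
    then obtain t u where tu: "(s, t) \<in> id_except K x" "(t, u) \<in> rel_compl K r"
      "(u, v) \<in> id_except K x"
      unfolding rel_loc_def by blast
    have "(s, v) \<notin> r"
      using *[OF id_except_sym[OF tu(1)] _ id_except_sym[OF tu(3)]] tu(2)
      unfolding rel_compl_def by blast
    then show "(s, v) \<in> rel_compl K r"
      using tu(1,3) id_except_subset[of K x] unfolding rel_compl_def all_rel_def by blast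
  qed
  show "rel_compl K r \<subseteq> rel_loc K x (rel_compl K r)"
    using id_except_refl[of _ K x] unfolding rel_loc_def rel_compl_def all_rel_def by blast
qed

context
  fixes V :: "'v set" and F :: "'v \<Rightarrow> 'c::complete_lattice \<Rightarrow> 'c" and x :: 'v
  assumes F: "localisation_family V F" and x: "x \<in> V"
begin

lemma localisation_family_extensive: "c \<le> F x c"
  using F x unfolding localisation_family_def by blast

lemma localisation_family_Sup: "F x (\<Squnion>C) = (\<Squnion>c \<in> C. F x c)"
  using F x unfolding localisation_family_def by blast

lemma localisation_family_sup: "F x (c \<squnion> d) = F x c \<squnion> F x d"
  using localisation_family_Sup[of "{c, d}"] by simp

lemma localisation_family_mono: "c \<le> d \<Longrightarrow> F x c \<le> F x d"
  using localisation_family_sup[of c d] by (simp add: le_iff_sup)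

lemma localisation_family_top: "F x \<top> = \<top>"
  using localisation_family_extensive top_unique by blast

lemma localisation_family_idem: "F x (F x c) = F x c"
proof -
  \<comment> \<open>Idempotence is the meet axiom taken at \<open>\<top>\<close>, which extensivity
    makes a fixed point of \<open>F x\<close>.\<close>
  have "F x (\<top> \<sqinter> F x c) = F x \<top> \<sqinter> F x c"
    using F x unfolding localisation_family_def by blast
  then show ?thesis by (simp add: localisation_family_top)
qed

end

lemma complete_boolean_subalgebra_sup:
  assumes "complete_boolean_subalgebra B" "a \<in> B" "b \<in> B"
  shows "a \<squnion> b \<in> B"
proof -
  have "\<forall>D \<subseteq> B. \<Squnion>D \<in> B"
    using assms(1) by (simp add: complete_boolean_subalgebra_def)
  then have "\<Squnion>{a, b} \<in> B"
    \<comment> \<open>\<open>Sup_insert\<close> would turn the join of the pair into a binary join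
      before the closure property could match.\<close>
    using assms(2,3) by (simp del: Sup_insert)
  then show ?thesis by simp
qed

text \<open>\<open>cpow\<close> unfolds on the left, whereas \<open>loc_seq_atomic\<close> splits
  off a last step.\<close>

lemma (in command_algebra) cpow_Suc_right: "cpow K c (Suc i) = cpow K c i ;; c"
proof (induction i)
  case 0
  show ?case by (simp add: nil_seq seq_nil)
next
  case (Suc i)
  have "cpow K c (Suc (Suc i)) = c ;; (cpow K c i ;; c)"
    using Suc.IH by simp
  then show ?case by (simp add: seq_assoc)
qed

context localised_command_algebra
begin

text \<open>\<open>loc_last\<close> lies between the identity and \<open>loc\<close>, so idempotence
  of \<open>loc\<close> absorbs it.\<close>

lemma loc_loc_last:
  assumes x: "x \<in> vars K"
  shows "loc K x (loc_last K x c) = loc K x c"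
proof (rule antisym)
  show "loc K x (loc_last K x c) \<le> loc K x c"
    using localisation_family_mono[OF loc_family x loc_last_le_loc[OF x]]
    by (simp add: localisation_family_idem[OF loc_family x])
  show "loc K x c \<le> loc K x (loc_last K x c)"
    by (rule localisation_family_mono[OF loc_family x
          localisation_family_extensive[OF loc_last_family x]])
qed

lemma loc_first_loc:
  assumes x: "x \<in> vars K"
  shows "loc_first K x (loc K x c) = loc K x c"
proof (rule antisym)
  show "loc_first K x (loc K x c) \<le> loc K x c"
    using loc_first_le_loc[OF x, of "loc K x c"]
    by (simp add: localisation_family_idem[OF loc_family x])
  show "loc K x c \<le> loc_first K x (loc K x c)"
    by (rule localisation_family_extensive[OF loc_first_family x])
qed

lemma loc_nil: "x \<in> vars K \<Longrightarrow> loc K x nil = nil"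
  using loc_test[of x "states K"] by (simp add: set_loc_states test_states)

lemma loc_first_nil: "x \<in> vars K \<Longrightarrow> loc_first K x nil = nil"
  using loc_first_test[of x "states K"] by (simp add: set_loc_states test_states)

lemma loc_seq_atomic:
  assumes x: "x \<in> vars K" and a: "a \<in> atomic K" and last: "loc K x a = loc_last K x a"
  shows "loc K x (d ;; a) = loc K x d ;; loc K x a"
proof -
  have "loc K x (d ;; a) = loc K x (loc_last K x (d ;; a))"
    by (simp add: loc_loc_last[OF x])
  \<comment> \<open>Since \<open>a\<close> is atomic, \<open>loc_last\<close> passes over
    \<open>d\<close> onto \<open>a\<close>, where it agrees with \<open>loc\<close> by assumption.
    The redundant \<open>loc_first\<close> gives the shape required by
    \<open>loc_seq_loc_first\<close>.\<close>
  also have "\<dots> = loc K x (d ;; loc_first K x (loc K x a))"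
    by (simp add: loc_last_seq[OF x atomic_wconj[OF a]] last[symmetric] loc_first_loc[OF x])
  also have "\<dots> = loc K x d ;; loc K x a"
    by (simp only: loc_seq_loc_first[OF x] localisation_family_idem[OF loc_family x])
  finally show ?thesis .
qed

lemma loc_cpow:
  assumes "x \<in> vars K" "a \<in> atomic K" "loc K x a = loc_last K x a"
  shows "loc K x (cpow K a i) = cpow K (loc K x a) i"
proof (induction i)
  case 0
  show ?case by (simp add: loc_nil assms(1))
next
  case (Suc i)
  then show ?case
    by (simp only: cpow_Suc_right loc_seq_atomic[OF assms])
qed

lemma loc_star:
  assumes "x \<in> vars K" "a \<in> atomic K" "loc K x a = loc_last K x a"
  shows "loc K x (star K a) = star K (loc K x a)"
  by (simp add: star_eq_Sup localisation_family_Sup[OF loc_family assms(1)] image_image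
      loc_cpow[OF assms])

lemma loc_omega:
  assumes "x \<in> vars K" "a \<in> atomic K" "loc K x a = loc_last K x a"
  shows "loc K x (omega K a) = omega K (loc K x a)"
  by (simp add: omega_decomp[of a] omega_decomp[of "loc K x a"] loc_star[OF assms]
      localisation_family_sup[OF loc_family assms(1)] loc_infin[OF assms])

text \<open>Common form of \<open>guar\<close>, \<open>demand\<close> and \<open>chaos\<close>: one
  or both relations are universal, and the universal relation is fixed by both
  \<open>rel_loc\<close> and \<open>rel_loc_last\<close>.\<close>

lemma loc_omega_pgm_env:
  assumes x: "x \<in> vars K" and sub: "p \<subseteq> all_rel K" "q \<subseteq> all_rel K"
    and last: "rel_loc K x p = rel_loc_last K x p" "rel_loc K x q = rel_loc_last K x q"
  shows "loc K x (omega K (\<pi> p \<squnion> \<epsilon> q)) = omega K (\<pi> (rel_loc K x p) \<squnion> \<epsilon> (rel_loc K x q))"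
proof -
  have a: "\<pi> p \<squnion> \<epsilon> q \<in> atomic K"
    by (intro complete_boolean_subalgebra_sup atomic_subalgebra pgm_atomic env_atomic sub)
  have E: "loc K x (\<pi> p \<squnion> \<epsilon> q) = \<pi> (rel_loc K x p) \<squnion> \<epsilon> (rel_loc K x q)"
    by (simp add: localisation_family_sup[OF loc_family x] loc_pgm[OF x] loc_env[OF x] sub)
  have "loc_last K x (\<pi> p \<squnion> \<epsilon> q) = \<pi> (rel_loc K x p) \<squnion> \<epsilon> (rel_loc K x q)"
    by (simp add: localisation_family_sup[OF loc_last_family x] loc_last_pgm[OF x]
        loc_last_env[OF x] sub last)
  then show ?thesis
    using loc_omega[OF x a] E by simp
qed

lemma loc_guar:
  assumes "x \<in> vars K" "r \<subseteq> all_rel K" "rel_loc K x r = rel_loc_last K x r"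
  shows "loc K x (guar K r) = guar K (rel_loc K x r)"
  using loc_omega_pgm_env[of x r "all_rel K"] assms
  by (simp add: guar_def any_env_def rel_loc_all_rel rel_loc_last_all_rel)

lemma loc_demand:
  assumes "x \<in> vars K" "r \<subseteq> all_rel K" "rel_loc K x r = rel_loc_last K x r"
  shows "loc K x (demand K r) = demand K (rel_loc K x r)"
  using loc_omega_pgm_env[of x "all_rel K" r] assms
  by (simp add: demand_def any_pgm_def rel_loc_all_rel rel_loc_last_all_rel sup_commute)

lemma loc_chaos: "x \<in> vars K \<Longrightarrow> loc K x (chaos K) = chaos K"
  using loc_omega_pgm_env[of x "all_rel K" "all_rel K"]
  by (simp add: chaos_def any_step_def any_pgm_def any_env_def rel_loc_all_rel
      rel_loc_last_all_rel)

lemma loc_rely: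
  assumes x: "x \<in> vars K" and r: "r \<subseteq> all_rel K" and inv: "rel_loc K x r = r"
  shows "loc K x (rely K r) = rely K r"
proof -
  let ?q = "rel_compl K r"
  let ?d = "nil \<squnion> \<epsilon> ?q ;; \<top>"
  have q: "?q \<subseteq> all_rel K" by (auto simp: rel_compl_def)
  have loc_q: "rel_loc K x ?q = ?q" by (rule rel_loc_rel_compl[OF inv])
  \<comment> \<open>In \<open>\<epsilon> ?q ;; \<top>\<close> the operator acts on the atomic first
    step alone, and \<open>?q\<close> is invariant.\<close>
  have "loc_first K x ?d = ?d"
    by (simp add: localisation_family_sup[OF loc_first_family x] loc_first_nil[OF x]
        loc_first_seq[OF x atomic_wconj[OF env_atomic[OF q]]] loc_first_env[OF x q]
        rel_loc_first_eq_self[OF q loc_q])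
  then have "loc K x (chaos K ;; ?d) = chaos K ;; loc K x ?d"
    using loc_seq_loc_first[OF x, of "chaos K" ?d] by (simp add: loc_chaos[OF x])
  \<comment> \<open>The same splitting law applies again because \<open>\<top>\<close> is fixed by
    \<open>loc_first\<close>; it is fixed by \<open>loc\<close> too.\<close>
  moreover have "loc K x (\<epsilon> ?q ;; \<top>) = \<epsilon> ?q ;; \<top>"
    using loc_seq_loc_first[OF x, of "\<epsilon> ?q" \<top>]
    by (simp add: localisation_family_top[OF loc_first_family x]
        localisation_family_top[OF loc_family x] loc_env[OF x q] loc_q)
  then have "loc K x ?d = ?d"
    by (simp add: localisation_family_sup[OF loc_family x] loc_nil[OF x])
  ultimately show ?thesis
    by (simp add: rely_alt[OF r] chaos_def[symmetric])
qed

end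

theorem mainTheorem4:
  fixes K :: "('v, 's, 'c::{complete_lattice, distrib_lattice}) command_structure"
    and r :: "('v \<rightharpoonup> 's) rel"
    and x :: 'v
  assumes "localised_command_algebra K"
    and "r \<subseteq> states K \<times> states K"
    and "x \<in> vars K"
  shows "(rel_loc K x r = rel_loc_last K x r \<longrightarrow>
            guar K (rel_loc K x r) = loc K x (guar K r)) \<and>
         (rel_loc K x r = rel_loc_last K x r \<longrightarrow>
            demand K (rel_loc K x r) = loc K x (demand K r)) \<and>
         (rel_loc K x r = r \<longrightarrow>
            rely K (rel_loc K x r) = loc K x (rely K r))"
proof -
  interpret localised_command_algebra K by (rule assms(1))
  have r: "r \<subseteq> all_rel K" using assms(2) by (simp add: all_rel_def)
  show ?thesis
    by (simp add: loc_guar[OF assms(3) r] loc_demand[OF assms(3) r] loc_rely[OF assms(3) r])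
qed

end
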